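(* Let $D$ be a point, $\mathcal{I}$ an inversion circle centred at $D$, and $\mathcal{C}$ a circle not passing through $D$. For any triangle inscribed in $\mathcal{C}$ and having no side line through $D$, the negative-pedal circle of the triangle with respect to $D$ and the inverse (with respect to $\mathcal{I}$) of its pedal-circle with respect to $D$ are homothetic. Moreover, two triangles inscribed in $\mathcal{C}$, with no side line through $D$, share the same pedal-circle $\mathcal{E}_D$ with respect to $D$ if and only if they share the same negative-pedal circle $\mathcal{C}_D$ with respect to $D$.
   Context: All objects are in the real Euclidean plane and triangles are non-degenerate. A "side" of a triangle means the full line through two of its vertices. For a point $D$ neither on the sides nor on the circumcircle of a triangle, the pedal-circle of the triangle with respect to $D$ is the circle through the feet of the perpendiculars from $D$ to its three sides; the negative-pedal triangle with respect to $D$ is the triangle whose side lines are the perpendiculars, through each vertex $V$, to the line $DV$; the negative-pedal circle is the circumcircle of the negative-pedal triangle. *)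

theory Defs
  imports "HOL-Analysis.Analysis"
begin

text \<open>Circles are sets of points. A triangle is given by its vertices A, B, C, and its sides are
  the full lines \<open>affine hull {A, B}\<close> etc.\<close>

type_synonym point = "real^2"

definition is_circle :: "point set \<Rightarrow> bool" where
  "is_circle K \<longleftrightarrow> (\<exists>c \<rho>. \<rho> > 0 \<and> K = sphere c \<rho>)"

definition triangle :: "point \<Rightarrow> point \<Rightarrow> point \<Rightarrow> bool" where
  "triangle A B C \<longleftrightarrow> \<not> collinear {A, B, C}"

definition no_side_through :: "point \<Rightarrow> point \<Rightarrow> point \<Rightarrow> point \<Rightarrow> bool" where
  "no_side_through D A B C \<longleftrightarrow>
     D \<notin> affine hull {A, B} \<and> D \<notin> affine hull {B, C} \<and> D \<notin> affine hull {C, A}"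

definition inscribed_avoiding :: "point set \<Rightarrow> point \<Rightarrow> point \<Rightarrow> point \<Rightarrow> point \<Rightarrow> bool" where
  "inscribed_avoiding K D A B C \<longleftrightarrow>
     triangle A B C \<and> A \<in> K \<and> B \<in> K \<and> C \<in> K \<and> no_side_through D A B C"

definition circle_through :: "point \<Rightarrow> point \<Rightarrow> point \<Rightarrow> point set" where
  "circle_through P Q S = (THE K. is_circle K \<and> P \<in> K \<and> Q \<in> K \<and> S \<in> K)"

text \<open>The foot of the perpendicular from D to the line AB (for distinct A, B).\<close>

definition foot :: "point \<Rightarrow> point \<Rightarrow> point \<Rightarrow> point" where
  "foot D A B = (THE F. F \<in> affine hull {A, B} \<and> orthogonal (F - D) (B - A))"

definition pedal_circle :: "point \<Rightarrow> point \<Rightarrow> point \<Rightarrow> point \<Rightarrow> point set" where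
  "pedal_circle D A B C = circle_through (foot D B C) (foot D C A) (foot D A B)"

text \<open>The line through V perpendicular to the line DV (for V distinct from D).\<close>

definition neg_pedal_line :: "point \<Rightarrow> point \<Rightarrow> point set" where
  "neg_pedal_line D V = {X. orthogonal (X - V) (V - D)}"

definition neg_pedal_vertex :: "point \<Rightarrow> point \<Rightarrow> point \<Rightarrow> point" where
  "neg_pedal_vertex D V W = (THE X. X \<in> neg_pedal_line D V \<and> X \<in> neg_pedal_line D W)"

definition neg_pedal_circle :: "point \<Rightarrow> point \<Rightarrow> point \<Rightarrow> point \<Rightarrow> point set" where
  "neg_pedal_circle D A B C =
     circle_through (neg_pedal_vertex D B C) (neg_pedal_vertex D C A) (neg_pedal_vertex D A B)"

definition inversion :: "point \<Rightarrow> real \<Rightarrow> point \<Rightarrow> point" where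
  "inversion D r X = D + (r\<^sup>2 / (dist D X)\<^sup>2) *\<^sub>R (X - D)"

text \<open>The centre of inversion has no inverse, so it is removed before taking the image.\<close>

definition inverse_set :: "point \<Rightarrow> real \<Rightarrow> point set \<Rightarrow> point set" where
  "inverse_set D r S = inversion D r ` (S - {D})"

definition homothety :: "point \<Rightarrow> real \<Rightarrow> point \<Rightarrow> point" where
  "homothety P k X = P + k *\<^sub>R (X - P)"

definition homothetic :: "point set \<Rightarrow> point set \<Rightarrow> bool" where
  "homothetic S T \<longleftrightarrow> (\<exists>P k. k \<noteq> 0 \<and> homothety P k ` S = T)"

end

theory Submission
  imports Defs
begin

text \<open>
  The poles of the three side lines with respect to the inversion circle link the two circles of
  the theorem. Measure positions from D, let u, v be two vertices, and let g be the pole of the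
  line joining them, that is, the point with \<open>g \<bullet> u = g \<bullet> v = r\<^sup>2\<close>. On the one hand, g is the
  inverse of the foot of the perpendicular from D to that line (\<open>foot_eq_inversion_pole\<close>). On the
  other hand, the vertex x of the negative-pedal triangle is given by \<open>x \<bullet> u = u \<bullet> u\<close> and
  \<open>x \<bullet> v = v \<bullet> v\<close>. If q is the centre of the given circle and p the power of D, then the circle
  has equation \<open>u \<bullet> u = 2 * (q \<bullet> u) - p\<close>, so \<open>x - 2 q\<close> has inner product \<open>- p\<close> with both u and v
  and must be \<open>- (p / r\<^sup>2)\<close> times g (\<open>neg_pedal_vertex_eq\<close>).

  Hence the map \<open>g \<mapsto> 2 q - (p / r\<^sup>2) g\<close> carries the poles to the vertices of the negative-pedal
  triangle, and it depends only on D and the circle, not on the triangle. As \<open>p \<noteq> 0\<close>, it is a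
  bijection of the plane, and it preserves circles. Let E be the circumcircle of the three poles.
  The pedal circle is the inverse of E and the negative-pedal circle is the image of E under this
  map (\<open>pole_circle\<close>). Both circles determine E, so each determines the other.

  Two degenerate cases have to be excluded before this makes sense. The poles are not collinear,
  since the sides of a triangle are neither concurrent nor all parallel
  (\<open>dual_triangle_not_collinear\<close>). And E does not pass through D: otherwise the feet would be
  collinear, which by Simson's theorem happens only when D lies on the circumcircle
  (\<open>dual_circumcircle_avoids_origin\<close>).

  If \<open>p = - r\<^sup>2\<close>, the map above is a translation and need not be a homothety. The two circles are
  then congruent and the point reflection in the midpoint of their centres exchanges them; in
  general, any two circles are related by a homothety of negative ratio (\<open>homothetic_circles\<close>).
\<close>

section \<open>Determinants and collinearity in the plane\<close>

definition det2 :: "point \<Rightarrow> point \<Rightarrow> real" where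
  "det2 u v = u $ 1 * v $ 2 - u $ 2 * v $ 1"

definition rot90 :: "point \<Rightarrow> point" where
  "rot90 u = vector [- u $ 2, u $ 1]"

lemma inner_coords: "u \<bullet> v = u $ 1 * v $ 1 + u $ 2 * v $ 2" for u v :: point
  by (simp add: inner_vec_def sum_2)

lemma point_eq_iff: "u = v \<longleftrightarrow> u $ 1 = v $ 1 \<and> u $ 2 = v $ 2" for u v :: point
  by (simp add: vec_eq_iff forall_2)

lemma rot90_coords [simp]: "rot90 u $ 1 = - u $ 2" "rot90 u $ 2 = u $ 1"
  by (simp_all add: rot90_def vector_2)

lemma norm_sq_inner: "(norm u)\<^sup>2 = u \<bullet> u" for u :: point
  by (simp add: power2_norm_eq_inner)

lemma inner_determines:
  assumes "det2 u v \<noteq> 0" "x \<bullet> u = y \<bullet> u" "x \<bullet> v = y \<bullet> v"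
  shows "x = y"
proof -
  have 1: "(x $ 1 - y $ 1) * u $ 1 + (x $ 2 - y $ 2) * u $ 2 = 0"
    and 2: "(x $ 1 - y $ 1) * v $ 1 + (x $ 2 - y $ 2) * v $ 2 = 0"
    using assms(2,3) by (simp_all add: inner_coords algebra_simps)
  have "(x $ 1 - y $ 1) * det2 u v = 0" "(x $ 2 - y $ 2) * det2 u v = 0"
    using 1 2 unfolding det2_def by algebra+
  then show ?thesis
    using assms(1) by (simp add: point_eq_iff)
qed

text \<open>Cramer's rule.\<close>

lemma inner_prescribed:
  assumes "det2 u v \<noteq> 0"
  obtains x where "x \<bullet> u = \<alpha>" "x \<bullet> v = \<beta>"
proof -
  define x where "x = (1 / det2 u v) *\<^sub>R (\<beta> *\<^sub>R rot90 u - \<alpha> *\<^sub>R rot90 v)"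
  have "det2 u v * (x \<bullet> u) = det2 u v * \<alpha>" "det2 u v * (x \<bullet> v) = det2 u v * \<beta>"
    using assms by (simp_all add: x_def inner_diff_left)
      (simp_all add: inner_coords det2_def algebra_simps)
  then show ?thesis
    using assms that by simp
qed

lemma collinear_iff_det2: "collinear {A, B, C} \<longleftrightarrow> det2 (B - A) (C - A) = 0" for A B C :: point
proof -
  \<comment> \<open>Lagrange's identity turns the equality case of Cauchy-Schwarz into a vanishing determinant.\<close>
  have sq: "(det2 u v)\<^sup>2 = (norm u * norm v)\<^sup>2 - (u \<bullet> v)\<^sup>2" for u v :: point
    unfolding power_mult_distrib norm_sq_inner inner_coords det2_def
    by (simp add: power2_eq_square algebra_simps)
  have "collinear {A, B, C} \<longleftrightarrow> collinear {B, A, C}"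
    by (simp only: insert_commute)
  also have "\<dots> \<longleftrightarrow> collinear {0, B - A, C - A}"
    by (rule collinear_3) (simp add: NO_MATCH_def)
  also have "\<dots> \<longleftrightarrow> \<bar>(B - A) \<bullet> (C - A)\<bar> = \<bar>norm (B - A) * norm (C - A)\<bar>"
    by (simp add: norm_cauchy_schwarz_equal)
  also have "\<dots> \<longleftrightarrow> (det2 (B - A) (C - A))\<^sup>2 = 0"
    unfolding sq abs_eq_iff right_minus_eq power2_eq_iff[of "norm _ * _"] by auto
  finally show ?thesis by simp
qed

lemma mem_line_iff_det2:
  assumes "A \<noteq> B"
  shows "X \<in> affine hull {A, B} \<longleftrightarrow> det2 (A - X) (B - X) = 0"
  using collinear_3_affine_hull[OF assms, of X] collinear_iff_det2[of X A B]
  by (simp add: insert_commute)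

section \<open>Circles\<close>

text \<open>The power of the point D with respect to the circle with centre c and radius \<open>\<rho>\<close>.\<close>

definition circle_power :: "point \<Rightarrow> point \<Rightarrow> real \<Rightarrow> real" where
  "circle_power D c \<rho> = (c - D) \<bullet> (c - D) - \<rho>\<^sup>2"

lemma circle_power_eq_0_iff:
  assumes "\<rho> > 0"
  shows "circle_power D c \<rho> = 0 \<longleftrightarrow> D \<in> sphere c \<rho>"
proof -
  have "circle_power D c \<rho> = (dist c D)\<^sup>2 - \<rho>\<^sup>2"
    by (simp add: circle_power_def dist_norm norm_sq_inner)
  then show ?thesis using assms by (simp add: power2_eq_iff_nonneg)
qed

text \<open>
  The equation of a circle in coordinates centred at D, with the power of D as its constant term.
  It makes the squared distance from D an affine function on the circle; this is what linearises
  the equations for the negative-pedal triangle.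
\<close>

lemma on_circle_inner_iff:
  assumes "\<rho> > 0"
  shows "X \<in> sphere c \<rho> \<longleftrightarrow>
    (X - D) \<bullet> (X - D) = 2 * ((c - D) \<bullet> (X - D)) - circle_power D c \<rho>"
proof -
  have "X \<in> sphere c \<rho> \<longleftrightarrow> circle_power X c \<rho> = 0"
    using circle_power_eq_0_iff[OF assms] by simp
  also have "c - X = (c - D) - (X - D)" by simp
  then have "circle_power X c \<rho> =
      (X - D) \<bullet> (X - D) - 2 * ((c - D) \<bullet> (X - D)) + circle_power D c \<rho>"
    unfolding circle_power_def
    by (simp only: inner_diff_left[of "c - D" "X - D"] inner_diff_right[of _ "c - D" "X - D"])
      (simp add: inner_commute)
  finally show ?thesis by linarith
qed

text \<open>
  On a line parametrised by \<open>k\<close>, a circle through the points with \<open>k = 0\<close> and \<open>k = 1\<close> is given by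
  a quadratic equation with exactly these two roots. Thus three distinct points are known to form
  a triangle once a circle through them is known.
\<close>

lemma distinct_on_circle_not_collinear:
  fixes P Q S :: point
  assumes "P \<in> sphere c \<rho>" "Q \<in> sphere c \<rho>" "S \<in> sphere c \<rho>" "P \<noteq> Q" "P \<noteq> S" "Q \<noteq> S"
  shows "\<not> collinear {P, Q, S}"
proof
  assume "collinear {P, Q, S}"
  then have "collinear {Q, P, S}" by (simp only: insert_commute)
  then have "collinear {0, Q - P, S - P}" by (subst (asm) collinear_3) (simp_all add: NO_MATCH_def)
  then obtain k where k: "S - P = k *\<^sub>R (Q - P)"
    using assms(4,5) by (auto simp: collinear_lemma)
  define v where "v = Q - P"
  define p where "p = P - c"
  have Q: "Q - c = p + v" and S: "S - c = p + k *\<^sub>R v"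
    using k by (simp_all add: v_def p_def algebra_simps)
  have "norm (p + v) = norm p" "norm (p + k *\<^sub>R v) = norm p"
    using assms(1,2,3) unfolding Q[symmetric] S[symmetric] unfolding p_def
    by (simp_all add: dist_norm norm_minus_commute)
  then have "(p + v) \<bullet> (p + v) = p \<bullet> p" "(p + k *\<^sub>R v) \<bullet> (p + k *\<^sub>R v) = p \<bullet> p"
    unfolding norm_sq_inner[symmetric] by simp_all
  then have 1: "2 * (p \<bullet> v) + v \<bullet> v = 0" and 2: "k * (2 * (p \<bullet> v)) + k * k * (v \<bullet> v) = 0"
    by (simp_all add: inner_add_left inner_add_right inner_commute algebra_simps)
  from 1 2 have "k * (k - 1) * (v \<bullet> v) = 0" by algebra
  then show False
    using k assms(4-6) by (auto simp: v_def)
qed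

text \<open>
  The circumcentre lies on two perpendicular bisectors. These are given by linear conditions on
  its position relative to P, with a non-zero determinant.
\<close>

lemma circumcircle_exists:
  fixes P Q S :: point
  assumes "\<not> collinear {P, Q, S}"
  obtains c \<rho> where "\<rho> > 0" "P \<in> sphere c \<rho>" "Q \<in> sphere c \<rho>" "S \<in> sphere c \<rho>"
proof -
  have "det2 (Q - P) (S - P) \<noteq> 0" using assms by (simp add: collinear_iff_det2)
  then obtain x where x: "x \<bullet> (Q - P) = (norm (Q - P))\<^sup>2 / 2" "x \<bullet> (S - P) = (norm (S - P))\<^sup>2 / 2"
    by (rule inner_prescribed)
  define c where "c = P + x"
  have *: "norm (x - v) = norm x" if "x \<bullet> v = (norm v)\<^sup>2 / 2" for v
  proof -
    have "(norm (x - v))\<^sup>2 = (norm x)\<^sup>2"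
      using that unfolding norm_sq_inner by (simp add: inner_diff_left inner_diff_right inner_commute)
    then show ?thesis by simp
  qed
  have "dist c Q = norm x" "dist c S = norm x" "dist c P = norm x"
    using *[OF x(1)] *[OF x(2)] by (simp_all add: c_def dist_norm algebra_simps)
  moreover have "norm x > 0"
    using x assms by auto
  ultimately show ?thesis by (intro that[of "norm x" c]) auto
qed

lemma circle_through_eq:
  assumes "\<not> collinear {P, Q, S}" "is_circle K" "P \<in> K" "Q \<in> K" "S \<in> K"
  shows "circle_through P Q S = K"
  unfolding circle_through_def
proof (rule the_equality)
  fix L assume L: "is_circle L \<and> P \<in> L \<and> Q \<in> L \<and> S \<in> L"
  obtain c \<rho> where K: "K = sphere c \<rho>" "\<rho> > 0" using assms(2) by (auto simp: is_circle_def)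
  obtain d \<sigma> where L': "L = sphere d \<sigma>" "\<sigma> > 0" using L by (auto simp: is_circle_def)
  have det: "det2 (Q - P) (S - P) \<noteq> 0" using assms(1) by (simp add: collinear_iff_det2)
  have *: "(z - P) \<bullet> (X - P) = (X - P) \<bullet> (X - P) / 2"
    if "t > 0" "P \<in> sphere z t" "X \<in> sphere z t" for z X :: point and t
    using on_circle_inner_iff[OF that(1), of X z P] circle_power_eq_0_iff[OF that(1), of P z] that by simp
  have "c - P = d - P"
    by (rule inner_determines[OF det]) (use assms L K L' * in metis)+
  then have "c = d" by simp
  moreover have "\<rho> = \<sigma>" using L L' K assms(3) \<open>c = d\<close> by auto
  ultimately show "L = K" using K L' by simp
qed (use assms in auto)

lemma affine_image_sphere:
  fixes c d :: point
  assumes "k \<noteq> 0"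
  shows "(\<lambda>X. d + k *\<^sub>R (X - c)) ` sphere c \<rho> = sphere d (\<bar>k\<bar> * \<rho>)"
proof (intro equalityI subsetI)
  fix Y assume "Y \<in> sphere d (\<bar>k\<bar> * \<rho>)"
  then have "c + (1/k) *\<^sub>R (Y - d) \<in> sphere c \<rho>"
    using assms by (simp add: dist_norm norm_minus_commute)
  moreover have "Y = d + k *\<^sub>R (c + (1/k) *\<^sub>R (Y - d) - c)" using assms by simp
  ultimately show "Y \<in> (\<lambda>X. d + k *\<^sub>R (X - c)) ` sphere c \<rho>" by blast
qed (auto simp: dist_norm norm_minus_commute)

text \<open>
  A negative ratio never equals 1, so the centre, which solves \<open>(1 - k) P = d - k c\<close>, exists also
  for congruent circles, where the positive ratio would only give a translation.
\<close>

lemma homothetic_circles: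
  assumes "is_circle S" "is_circle T"
  shows "homothetic S T"
proof -
  obtain c \<rho> d \<sigma> where S: "S = sphere c \<rho>" "\<rho> > 0" and T: "T = sphere d \<sigma>" "\<sigma> > 0"
    using assms by (auto simp: is_circle_def)
  define k where "k = - (\<sigma> / \<rho>)"
  have "k < 0" using S T by (simp add: k_def)
  define P where "P = (1 / (1 - k)) *\<^sub>R (d - k *\<^sub>R c)"
  have "(1 - k) *\<^sub>R P = d - k *\<^sub>R c" using \<open>k < 0\<close> by (simp add: P_def)
  then have "homothety P k X = d + k *\<^sub>R (X - c)" for X
    by (simp add: homothety_def algebra_simps)
  then have "homothety P k ` S = sphere d (\<bar>k\<bar> * \<rho>)"
    using affine_image_sphere[of k d c \<rho>] \<open>k < 0\<close> S by simp
  also have "\<dots> = T" using S T by (simp add: k_def)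
  finally show ?thesis using \<open>k < 0\<close> unfolding homothetic_def by (metis less_irrefl)
qed

section \<open>Inversion\<close>

lemma inversion_minus: "inversion D r X - D = (r\<^sup>2 / ((X - D) \<bullet> (X - D))) *\<^sub>R (X - D)"
  unfolding norm_sq_inner[symmetric] by (simp add: inversion_def dist_norm norm_minus_commute)

lemma inversion_involution:
  assumes "r > 0" "X \<noteq> D"
  shows "inversion D r (inversion D r X) = X"
proof -
  define x where "x = X - D"
  have x: "x \<bullet> x > 0" using assms by (simp add: x_def)
  have i: "inversion D r X - D = (r\<^sup>2 / (x \<bullet> x)) *\<^sub>R x" by (simp add: inversion_minus x_def)
  have "inversion D r (inversion D r X) - D = x"
    unfolding inversion_minus[of D r "inversion D r X"] i using x assms by (simp add: field_simps power2_eq_square)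
  then show "inversion D r (inversion D r X) = X" by (simp add: x_def)
qed

text \<open>
  With \<open>x\<close> the position of a point of the circle relative to D, the equation of the circle says
  \<open>2 (x \<bullet> q) = x \<bullet> x + p\<close>. Divided by \<open>p (x \<bullet> x)\<close>, it becomes the equation of a circle centred
  at \<open>q / p\<close> for the point \<open>x / (x \<bullet> x)\<close>.
\<close>

lemma inversion_maps_circle:
  fixes c D :: point
  assumes "r > 0" "\<rho> > 0" "D \<notin> sphere c \<rho>"
  defines "p \<equiv> circle_power D c \<rho>"
  assumes "X \<in> sphere c \<rho>"
  shows "inversion D r X \<in> sphere (D + (r\<^sup>2 / p) *\<^sub>R (c - D)) (r\<^sup>2 * \<rho> / \<bar>p\<bar>)"
proof -
  define x where "x = X - D"
  define q where "q = c - D"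
  have "p \<noteq> 0" using assms(2,3) by (simp add: p_def circle_power_eq_0_iff)
  have "x \<noteq> 0" using assms by (auto simp: x_def)
  then have n: "x \<bullet> x > 0" by simp
  have xq: "2 * (x \<bullet> q) = x \<bullet> x + p"
    using assms on_circle_inner_iff[OF assms(2), of X c D] by (simp add: x_def q_def inner_commute)
  have qq: "q \<bullet> q = p + \<rho>\<^sup>2" by (simp add: p_def q_def circle_power_def)
  let ?y = "(1 / (x \<bullet> x)) *\<^sub>R x - (1 / p) *\<^sub>R q"
  have "?y \<bullet> ?y = 1 / (x \<bullet> x) - (2 * (x \<bullet> q)) / ((x \<bullet> x) * p) + (q \<bullet> q) / p\<^sup>2"
    using n by (simp add: inner_diff_left inner_diff_right inner_commute power2_eq_square)
  also have "\<dots> = (\<rho> / p)\<^sup>2"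
    unfolding xq qq using n \<open>p \<noteq> 0\<close> by (simp add: field_simps power2_eq_square)
  finally have y: "?y \<bullet> ?y = (\<rho> / p)\<^sup>2" .
  have e: "inversion D r X - (D + (r\<^sup>2 / p) *\<^sub>R (c - D)) = r\<^sup>2 *\<^sub>R ?y"
    using inversion_minus[of D r X] by (simp add: x_def q_def algebra_simps)
  have "norm ?y = \<rho> / \<bar>p\<bar>"
    by (rule power2_eq_imp_eq)
      (use y assms(2) in \<open>simp_all add: norm_sq_inner[symmetric] power_divide\<close>)
  then have "norm (r\<^sup>2 *\<^sub>R ?y) = r\<^sup>2 * \<rho> / \<bar>p\<bar>" by simp
  then show ?thesis
    unfolding e[symmetric] by (simp add: dist_norm norm_minus_commute)
qed

text \<open>
  The preceding lemma gives an inclusion between circles. As inversion is an involution, applying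
  the same lemma to the image circle gives the reverse inclusion.
\<close>

lemma inversion_circle:
  assumes "r > 0" "is_circle K" "D \<notin> K"
  shows "is_circle (inversion D r ` K)" "D \<notin> inversion D r ` K"
    "inversion D r ` (inversion D r ` K) = K"
proof -
  obtain c \<rho> where K: "K = sphere c \<rho>" "\<rho> > 0" using assms by (auto simp: is_circle_def)
  define p where "p = circle_power D c \<rho>"
  have "p \<noteq> 0" using assms(3) K by (simp add: p_def circle_power_eq_0_iff)
  define d \<sigma> where "d = D + (r\<^sup>2 / p) *\<^sub>R (c - D)" and "\<sigma> = r\<^sup>2 * \<rho> / \<bar>p\<bar>"
  have "\<sigma> > 0" using K assms \<open>p \<noteq> 0\<close> by (simp add: \<sigma>_def)
  have p': "circle_power D d \<sigma> = r\<^sup>2 * r\<^sup>2 / p"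
  proof -
    have "circle_power D d \<sigma> = (r\<^sup>2 / p)\<^sup>2 * ((c - D) \<bullet> (c - D)) - (r\<^sup>2 / p)\<^sup>2 * \<rho>\<^sup>2"
      by (simp add: circle_power_def d_def \<sigma>_def power_divide power_mult_distrib)
        (simp add: power2_eq_square)
    also have "\<dots> = (r\<^sup>2 / p)\<^sup>2 * p" by (simp add: p_def circle_power_def right_diff_distrib)
    finally have "circle_power D d \<sigma> = (r\<^sup>2 / p)\<^sup>2 * p" .
    then show ?thesis using \<open>p \<noteq> 0\<close> by (simp add: power2_eq_square)
  qed
  have "D \<notin> sphere d \<sigma>"
    using p' \<open>p \<noteq> 0\<close> assms(1) circle_power_eq_0_iff[OF \<open>\<sigma> > 0\<close>, of D d] by auto
  have fwd: "inversion D r ` K \<subseteq> sphere d \<sigma>"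
    using inversion_maps_circle[OF assms(1) K(2)] assms(3) unfolding K d_def \<sigma>_def p_def by blast
  \<comment> \<open>Applied to the image circle, the formulas for centre and radius return the original circle.\<close>
  have c: "D + (r\<^sup>2 / (r\<^sup>2 * r\<^sup>2 / p)) *\<^sub>R (d - D) = c"
    using \<open>p \<noteq> 0\<close> assms(1) by (simp add: d_def)
  have \<rho>: "r\<^sup>2 * \<sigma> / \<bar>r\<^sup>2 * r\<^sup>2 / p\<bar> = \<rho>"
    using \<open>p \<noteq> 0\<close> assms(1) by (simp add: \<sigma>_def abs_mult)
  have bwd: "inversion D r X \<in> K" if "X \<in> sphere d \<sigma>" for X
    using inversion_maps_circle[OF assms(1) \<open>\<sigma> > 0\<close> \<open>D \<notin> sphere d \<sigma>\<close> that] unfolding p' c \<rho> K .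
  have "sphere d \<sigma> \<subseteq> inversion D r ` K"
  proof
    fix X assume X: "X \<in> sphere d \<sigma>"
    then have "X = inversion D r (inversion D r X)"
      using inversion_involution[OF assms(1), of X D] \<open>D \<notin> sphere d \<sigma>\<close> by fastforce
    then show "X \<in> inversion D r ` K" using bwd[OF X] by blast
  qed
  with fwd have eq: "inversion D r ` K = sphere d \<sigma>" by blast
  show "is_circle (inversion D r ` K)" "D \<notin> inversion D r ` K"
    using eq \<open>\<sigma> > 0\<close> \<open>D \<notin> sphere d \<sigma>\<close> by (auto simp: is_circle_def)
  have "inversion D r (inversion D r X) = X" if "X \<in> K" for X
    using inversion_involution[OF assms(1)] assms(3) that by metis
  then show "inversion D r ` (inversion D r ` K) = K"
    by (simp add: image_image)
qed

section \<open>Poles of the side lines\<close>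

text \<open>
  The pole of the line through \<open>u\<close> and \<open>v\<close> with respect to the unit circle: the point whose inner
  product with every point of that line is 1.
\<close>

definition dual_pt :: "point \<Rightarrow> point \<Rightarrow> point" where
  "dual_pt u v = (1 / det2 u v) *\<^sub>R rot90 (u - v)"

lemma inner_dual_pt:
  assumes "det2 u v \<noteq> 0"
  shows "dual_pt u v \<bullet> u = 1" "dual_pt u v \<bullet> v = 1"
proof -
  have "rot90 (u - v) \<bullet> u = det2 u v" "rot90 (u - v) \<bullet> v = det2 u v"
    by (simp_all add: inner_coords det2_def algebra_simps)
  then show "dual_pt u v \<bullet> u = 1" "dual_pt u v \<bullet> v = 1"
    using assms by (simp_all add: dual_pt_def)
qed

text \<open>
  Any vector with equal inner products with \<open>u\<close> and \<open>v\<close> is a multiple of the pole; this will be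
  applied to the vertices of the negative-pedal triangle.
\<close>

lemma dual_pt_unique:
  assumes "det2 u v \<noteq> 0" "x \<bullet> u = t" "x \<bullet> v = t"
  shows "x = t *\<^sub>R dual_pt u v"
  by (rule inner_determines[OF assms(1)]) (use assms inner_dual_pt in auto)

lemma dual_pt_nonzero:
  assumes "det2 u v \<noteq> 0"
  shows "dual_pt u v \<noteq> 0"
  using inner_dual_pt(1)[OF assms] by force

text \<open>
  The origin has barycentric coordinates \<open>det2 v w : det2 w u : det2 u v\<close> with respect to the
  triangle \<open>u, v, w\<close>. Their sum is twice the signed area of the triangle, so it is non-zero exactly
  when the triangle is non-degenerate.
\<close>

lemma det2_barycentric: "det2 v w *\<^sub>R u + det2 w u *\<^sub>R v + det2 u v *\<^sub>R w = 0"
  by (simp add: point_eq_iff det2_def algebra_simps)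

text \<open>
  The poles of the two sides that meet in \<open>w\<close> both lie on the polar line of \<open>w\<close>, so their
  difference is a multiple of \<open>rot90 w\<close>, and likewise for \<open>v\<close>. The multiples are proportional to
  the area of \<open>u, v, w\<close>, and \<open>v\<close> and \<open>w\<close> are linearly independent.
\<close>

lemma dual_triangle_not_collinear:
  assumes "det2 u v \<noteq> 0" "det2 v w \<noteq> 0" "det2 w u \<noteq> 0"
    and "det2 v w + det2 w u + det2 u v \<noteq> 0"
  shows "det2 (dual_pt w u - dual_pt v w) (dual_pt u v - dual_pt v w) \<noteq> 0"
proof -
  let ?y1 = "dual_pt v w" and ?y2 = "dual_pt w u" and ?y3 = "dual_pt u v"
  define T where "T = det2 v w + det2 w u + det2 u v"
  have 2: "?y2 - ?y1 = (T / (det2 v w * det2 w u)) *\<^sub>R rot90 w"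
    using assms(2,3) unfolding dual_pt_def
    by (simp add: point_eq_iff T_def field_simps) (simp add: det2_def algebra_simps)
  have 3: "?y3 - ?y1 = - (T / (det2 v w * det2 u v)) *\<^sub>R rot90 v"
    using assms(1,2) unfolding dual_pt_def
    by (simp add: point_eq_iff T_def field_simps) (simp add: det2_def algebra_simps)
  have "det2 (s *\<^sub>R rot90 w) (t *\<^sub>R rot90 v) = - s * t * det2 v w" for s t
    by (simp add: det2_def algebra_simps)
  then have "det2 (?y2 - ?y1) (?y3 - ?y1) =
      - (T / (det2 v w * det2 w u)) * - (T / (det2 v w * det2 u v)) * det2 v w"
    unfolding 2 3 by blast
  then show ?thesis using assms by (simp add: T_def)
qed

text \<open>
  A circle through the origin with centre \<open>m / 2\<close> has equation \<open>y \<bullet> y = m \<bullet> y\<close>. By inversion,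
  this is the implication of Simson's theorem from collinear feet to a point on the circumcircle.
  With the barycentric coordinates \<open>a, b, c\<close> of the origin, it follows by evaluating the sum of
  \<open>b c \<bar>v - w\<bar>\<^sup>2\<close> and its cyclic permutations in two ways. If the three poles satisfy the equation,
  then the sum is \<open>a b c\<close> times an inner product of \<open>m\<close> with the sum of the rotated sides, which
  vanishes because the sides close up. But in general the sum equals \<open>(a + b + c)\<^sup>2 s\<close>, where
  \<open>- s\<close> is the power of the origin with respect to the circumcircle of \<open>u, v, w\<close>.
\<close>

lemma dual_circumcircle_avoids_origin:
  assumes "det2 u v \<noteq> 0" "det2 v w \<noteq> 0" "det2 w u \<noteq> 0"
    and "det2 v w + det2 w u + det2 u v \<noteq> 0"
    and circ: "u \<bullet> u = 2 * (q \<bullet> u) + s" "v \<bullet> v = 2 * (q \<bullet> v) + s" "w \<bullet> w = 2 * (q \<bullet> w) + s"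
    and "s \<noteq> 0"
  shows "\<exists>y \<in> {dual_pt v w, dual_pt w u, dual_pt u v}. y \<bullet> y \<noteq> m \<bullet> y"
proof (rule ccontr)
  assume "\<not> ?thesis"
  then have thru: "y \<bullet> y = m \<bullet> y" if "y \<in> {dual_pt v w, dual_pt w u, dual_pt u v}" for y
    using that by blast
  define a b c where "a = det2 v w" and "b = det2 w u" and "c = det2 u v"
  have thru': "(x - y) \<bullet> (x - y) = det2 x y * (m \<bullet> rot90 (x - y))"
    if "det2 x y \<noteq> 0" "dual_pt x y \<in> {dual_pt v w, dual_pt w u, dual_pt u v}" for x y
  proof -
    have "(x - y) \<bullet> (x - y) = (det2 x y)\<^sup>2 * (dual_pt x y \<bullet> dual_pt x y)"
      using that(1) by (simp add: dual_pt_def power2_eq_square) (simp add: inner_coords algebra_simps)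
    also have "\<dots> = (det2 x y)\<^sup>2 * (m \<bullet> dual_pt x y)" using thru[OF that(2)] by simp
    also have "\<dots> = det2 x y * (m \<bullet> rot90 (x - y))"
      using that(1) by (simp add: dual_pt_def power2_eq_square)
    finally show ?thesis .
  qed
  let ?S = "b * c * ((v - w) \<bullet> (v - w)) + c * a * ((w - u) \<bullet> (w - u)) + a * b * ((u - v) \<bullet> (u - v))"
  have "?S = a * b * c * (m \<bullet> (rot90 (v - w) + rot90 (w - u) + rot90 (u - v)))"
    using thru'[of v w] thru'[of w u] thru'[of u v] assms(1-3)
    by (simp add: a_def b_def c_def algebra_simps inner_add_right)
  also have "rot90 (v - w) + rot90 (w - u) + rot90 (u - v) = 0" by (simp add: point_eq_iff)
  finally have S0: "?S = 0" by simp
  let ?z = "a *\<^sub>R u + b *\<^sub>R v + c *\<^sub>R w"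
  have z: "?z = 0" unfolding a_def b_def c_def by (rule det2_barycentric)
  have "?S = (a + b + c) * (a * (u \<bullet> u) + b * (v \<bullet> v) + c * (w \<bullet> w)) - ?z \<bullet> ?z"
    by (simp add: inner_add_left inner_add_right inner_diff_left inner_diff_right inner_commute algebra_simps)
  also have "a * (u \<bullet> u) + b * (v \<bullet> v) + c * (w \<bullet> w) = 2 * (q \<bullet> ?z) + (a + b + c) * s"
    unfolding circ by (simp add: inner_add_right algebra_simps)
  finally have "?S = (a + b + c) * ((a + b + c) * s)" unfolding z by simp
  then show False using S0 assms(4) \<open>s \<noteq> 0\<close> by (simp add: a_def b_def c_def)
qed

text \<open>The pole of the line BC with respect to the circle with centre D and radius r.\<close>

definition pole :: "point \<Rightarrow> real \<Rightarrow> point \<Rightarrow> point \<Rightarrow> point" where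
  "pole D r B C = D + r\<^sup>2 *\<^sub>R dual_pt (B - D) (C - D)"

text \<open>
  A line is the polar of its pole, so it is perpendicular to the ray from D through the pole and
  meets that ray in the inverse of the pole.
\<close>

lemma foot_eq_inversion_pole:
  assumes "r > 0" "B \<noteq> C" "det2 (B - D) (C - D) \<noteq> 0"
  shows "foot D B C = inversion D r (pole D r B C)"
proof -
  define y where "y = dual_pt (B - D) (C - D)"
  define F where "F = D + (1 / (y \<bullet> y)) *\<^sub>R y"
  have y: "y \<bullet> y > 0" using dual_pt_nonzero[OF assms(3)] by (simp add: y_def)
  have yB: "y \<bullet> (B - D) = 1" and yC: "y \<bullet> (C - D) = 1"
    using inner_dual_pt[OF assms(3)] by (simp_all add: y_def)
  have BC: "rot90 (B - C) = det2 (B - D) (C - D) *\<^sub>R y"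
    using assms(3) by (simp add: y_def dual_pt_def)
  have line: "X \<in> affine hull {B, C} \<longleftrightarrow> (X - D) \<bullet> y = 1" for X
  proof -
    have "det2 (B - X) (C - X) = det2 (B - D) (C - D) - (X - D) \<bullet> rot90 (B - C)"
      by (simp add: det2_def inner_coords algebra_simps)
    then have "det2 (B - X) (C - X) = det2 (B - D) (C - D) * (1 - (X - D) \<bullet> y)"
      unfolding BC by (simp add: algebra_simps)
    then show ?thesis using mem_line_iff_det2[OF assms(2)] assms(3) by auto
  qed
  have perp: "y \<bullet> (C - B) = 0" using yB yC by (simp add: inner_diff_right)
  have "foot D B C = F"
    unfolding foot_def
  proof (rule the_equality)
    show "F \<in> affine hull {B, C} \<and> orthogonal (F - D) (C - B)"
      using y perp by (simp add: line F_def orthogonal_def)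
    fix X assume "X \<in> affine hull {B, C} \<and> orthogonal (X - D) (C - B)"
    then have X: "(X - D) \<bullet> y = 1" "(X - D) \<bullet> (C - B) = 0"
      by (simp_all add: line orthogonal_def)
    have "det2 (C - B) y * det2 (B - D) (C - D) = - ((B - C) \<bullet> (B - C))"
    proof -
      have "det2 (C - B) y * det2 (B - D) (C - D) = det2 (C - B) (rot90 (B - C))"
        unfolding BC by (simp add: det2_def algebra_simps)
      also have "\<dots> = - ((B - C) \<bullet> (B - C))" by (simp add: det2_def inner_coords algebra_simps)
      finally show ?thesis .
    qed
    then have "det2 (C - B) y \<noteq> 0" using assms(2) by auto
    then have "X - D = F - D"
      by (rule inner_determines) (use X perp y in \<open>simp_all add: F_def\<close>)
    then show "X = F" by simp
  qed
  moreover have "inversion D r (pole D r B C) - D = F - D"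
    unfolding inversion_minus using y assms(1)
    by (simp add: pole_def F_def y_def[symmetric] power2_eq_square)
  ultimately show ?thesis by simp
qed

text \<open>
  The map takes D to its reflection in the centre of the circle and scales by minus the power of D
  divided by \<open>r\<^sup>2\<close>; being independent of the triangle, it allows two triangles to be compared.
\<close>

definition pole_to_neg_pedal :: "point \<Rightarrow> real \<Rightarrow> point \<Rightarrow> real \<Rightarrow> point \<Rightarrow> point" where
  "pole_to_neg_pedal D r cen R X =
     D + 2 *\<^sub>R (cen - D) - (circle_power D cen R / r\<^sup>2) *\<^sub>R (X - D)"

text \<open>
  The perpendicular at V to DV consists of the points \<open>x\<close>, relative to D, with \<open>x \<bullet> v = v \<bullet> v\<close>. For
  \<open>v\<close> on the circle, the right-hand side is \<open>2 (q \<bullet> v) - p\<close>, so shifting \<open>x\<close> by \<open>2 q\<close> turns the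
  line into a multiple of the polar of \<open>v\<close>, with the same factor for every vertex.
\<close>

lemma neg_pedal_vertex_eq:
  fixes cen :: point
  assumes "r > 0" "R > 0" "det2 (B - D) (C - D) \<noteq> 0" "B \<in> sphere cen R" "C \<in> sphere cen R"
  shows "neg_pedal_vertex D B C = pole_to_neg_pedal D r cen R (pole D r B C)"
    (is "_ = ?X")
proof -
  define q where "q = cen - D"
  define s where "s = - circle_power D cen R"
  have line: "X \<in> neg_pedal_line D V \<longleftrightarrow> (X - D - 2 *\<^sub>R q) \<bullet> (V - D) = s"
    if "V \<in> sphere cen R" for X V
  proof -
    have V: "(V - D) \<bullet> (V - D) = 2 * (q \<bullet> (V - D)) + s"
      using that on_circle_inner_iff[OF assms(2), of V cen D] by (simp add: s_def q_def)
    have "X - V = (X - D) - (V - D)" by simp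
    then have "X \<in> neg_pedal_line D V \<longleftrightarrow> (X - D) \<bullet> (V - D) - (V - D) \<bullet> (V - D) = 0"
      by (simp only: neg_pedal_line_def orthogonal_def mem_Collect_eq inner_diff_left[of "X - D" "V - D"])
    then show ?thesis unfolding V by (simp add: inner_diff_left[of "X - D"]) argo
  qed
  have X: "?X - D - 2 *\<^sub>R q = s *\<^sub>R dual_pt (B - D) (C - D)"
    using assms(1) by (simp add: pole_to_neg_pedal_def pole_def q_def s_def)
  show ?thesis
    unfolding neg_pedal_vertex_def
  proof (rule the_equality)
    show "?X \<in> neg_pedal_line D B \<and> ?X \<in> neg_pedal_line D C"
      unfolding line[OF assms(4)] line[OF assms(5)] X using inner_dual_pt[OF assms(3)] by simp
    fix Z assume "Z \<in> neg_pedal_line D B \<and> Z \<in> neg_pedal_line D C"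
    then have "Z - D - 2 *\<^sub>R q = s *\<^sub>R dual_pt (B - D) (C - D)"
      by (intro dual_pt_unique assms(3)) (simp_all add: line[OF assms(4)] line[OF assms(5)])
    with X show "Z = ?X" by (simp add: algebra_simps)
  qed
qed

section \<open>The pedal and the negative-pedal circle\<close>

text \<open>
  E is the circumcircle of the poles of the sides. Since it avoids D, its inverse is a circle
  through the three feet; this also shows that the feet form a triangle, so that the pedal circle
  is determined by them. The same argument applies to the image under \<open>pole_to_neg_pedal\<close>.
\<close>

lemma pole_circle:
  fixes cen D :: point
  assumes "r > 0" "R > 0" "D \<notin> sphere cen R" "inscribed_avoiding (sphere cen R) D A B C"
  obtains E where "is_circle E" "D \<notin> E"
    "pedal_circle D A B C = inversion D r ` E"
    "neg_pedal_circle D A B C = pole_to_neg_pedal D r cen R ` E"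
    "is_circle (neg_pedal_circle D A B C)"
proof -
  define u v w where "u = A - D" and "v = B - D" and "w = C - D"
  define q where "q = cen - D"
  define s where "s = - circle_power D cen R"
  have onK: "A \<in> sphere cen R" "B \<in> sphere cen R" "C \<in> sphere cen R"
    and tri: "\<not> collinear {A, B, C}" and nos: "no_side_through D A B C"
    using assms(4) by (auto simp: inscribed_avoiding_def triangle_def)
  have ne: "A \<noteq> B" "B \<noteq> C" "C \<noteq> A" using tri by (auto simp: insert_commute)
  have dets: "det2 u v \<noteq> 0" "det2 v w \<noteq> 0" "det2 w u \<noteq> 0"
    using nos ne by (auto simp: no_side_through_def mem_line_iff_det2 u_def v_def w_def)
  have "det2 (B - A) (C - A) = det2 v w + det2 w u + det2 u v"
    by (simp add: u_def v_def w_def det2_def algebra_simps)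
  then have T: "det2 v w + det2 w u + det2 u v \<noteq> 0"
    using tri by (simp add: collinear_iff_det2)
  have circ: "(V - D) \<bullet> (V - D) = 2 * (q \<bullet> (V - D)) + s" if "V \<in> sphere cen R" for V
    using that on_circle_inner_iff[OF assms(2), of V cen D] by (simp add: s_def q_def)
  have "s \<noteq> 0" using assms(2,3) by (simp add: s_def circle_power_eq_0_iff)
  let ?G1 = "pole D r B C" and ?G2 = "pole D r C A" and ?G3 = "pole D r A B"
  have pole: "?G1 = D + r\<^sup>2 *\<^sub>R dual_pt v w" "?G2 = D + r\<^sup>2 *\<^sub>R dual_pt w u" "?G3 = D + r\<^sup>2 *\<^sub>R dual_pt u v"
    by (simp_all add: pole_def u_def v_def w_def)
  have "det2 (?G2 - ?G1) (?G3 - ?G1) = r\<^sup>2 * r\<^sup>2 * det2 (dual_pt w u - dual_pt v w) (dual_pt u v - dual_pt v w)"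
    unfolding pole by (simp add: det2_def algebra_simps)
  then have G: "\<not> collinear {?G1, ?G2, ?G3}"
    using dual_triangle_not_collinear[OF dets T] assms(1) by (simp add: collinear_iff_det2)
  then have Gne: "?G1 \<noteq> ?G2" "?G1 \<noteq> ?G3" "?G2 \<noteq> ?G3"
    by (auto simp: insert_commute)
  obtain c \<rho> where E: "\<rho> > 0" "?G1 \<in> sphere c \<rho>" "?G2 \<in> sphere c \<rho>" "?G3 \<in> sphere c \<rho>"
    using circumcircle_exists[OF G] by metis
  let ?E = "sphere c \<rho>"
  have D: "D \<notin> ?E"
  proof
    assume DE: "D \<in> ?E"
    have thru: "y \<bullet> y = ((2 / r\<^sup>2) *\<^sub>R (c - D)) \<bullet> y" if "D + r\<^sup>2 *\<^sub>R y \<in> ?E" for y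
    proof -
      have "circle_power D c \<rho> = 0" using DE circle_power_eq_0_iff[OF E(1)] by simp
      then have "r\<^sup>2 * (r\<^sup>2 * (y \<bullet> y)) = r\<^sup>2 * (2 * ((c - D) \<bullet> y))"
        using that on_circle_inner_iff[OF E(1), of "D + r\<^sup>2 *\<^sub>R y" c D] by simp
      then have "r\<^sup>2 * (y \<bullet> y) = 2 * ((c - D) \<bullet> y)"
        using assms(1) by (simp only: mult_cancel_left) auto
      then show ?thesis using assms(1) by (simp add: nonzero_eq_divide_eq mult.commute)
    qed
    have "y \<bullet> y = ((2 / r\<^sup>2) *\<^sub>R (c - D)) \<bullet> y"
      if y: "y \<in> {dual_pt v w, dual_pt w u, dual_pt u v}" for y
    proof (rule thru)
      show "D + r\<^sup>2 *\<^sub>R y \<in> ?E"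
        using y E(2-4) unfolding pole by (elim insertE emptyE) simp_all
    qed
    then show False
      using dual_circumcircle_avoids_origin[OF dets T
          circ[OF onK(1), folded u_def] circ[OF onK(2), folded v_def]
          circ[OF onK(3), folded w_def] \<open>s \<noteq> 0\<close>, of "(2 / r\<^sup>2) *\<^sub>R (c - D)"]
      by metis
  qed
  have circE: "is_circle ?E" using E by (auto simp: is_circle_def)
  let ?i = "inversion D r"
  have iE: "is_circle (?i ` ?E)" by (rule inversion_circle(1)[OF assms(1) circE D])
  have inj: "?i X \<noteq> ?i Y" if "X \<in> ?E" "Y \<in> ?E" "X \<noteq> Y" for X Y
    using inversion_involution[OF assms(1)] D that by metis
  have "\<not> collinear {?i ?G1, ?i ?G2, ?i ?G3}"
  proof -
    obtain d \<sigma> where d: "?i ` ?E = sphere d \<sigma>" using iE by (auto simp: is_circle_def)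
    show ?thesis
      by (rule distinct_on_circle_not_collinear[of _ d \<sigma>]) (use d E inj Gne in auto)
  qed
  then have "circle_through (?i ?G1) (?i ?G2) (?i ?G3) = ?i ` ?E"
    by (rule circle_through_eq[OF _ iE]) (use E in auto)
  then have pedal: "pedal_circle D A B C = ?i ` ?E"
    using foot_eq_inversion_pole[OF assms(1)] ne dets
    by (simp add: pedal_circle_def u_def v_def w_def)
  let ?h = "pole_to_neg_pedal D r cen R"
  have k: "s / r\<^sup>2 \<noteq> 0" using \<open>s \<noteq> 0\<close> assms(1) by simp
  define d where "d = ?h c"
  have h: "?h X = d + (s / r\<^sup>2) *\<^sub>R (X - c)" for X
    by (simp add: d_def pole_to_neg_pedal_def s_def algebra_simps)
  have hE: "?h ` ?E = sphere d (\<bar>s / r\<^sup>2\<bar> * \<rho>)"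
    unfolding h by (rule affine_image_sphere[OF k])
  then have chE: "is_circle (?h ` ?E)" using k E(1) unfolding is_circle_def
    by (metis mult_pos_pos zero_less_abs_iff)
  have hinj: "?h X \<noteq> ?h Y" if "X \<noteq> Y" for X Y
    using k that by (simp add: h)
  have "\<not> collinear {?h ?G1, ?h ?G2, ?h ?G3}"
    by (rule distinct_on_circle_not_collinear[of _ d "\<bar>s / r\<^sup>2\<bar> * \<rho>"])
      (use hE E hinj Gne in auto)
  then have "circle_through (?h ?G1) (?h ?G2) (?h ?G3) = ?h ` ?E"
    by (rule circle_through_eq[OF _ chE]) (use E in auto)
  then have "neg_pedal_circle D A B C = ?h ` ?E"
    using neg_pedal_vertex_eq[OF assms(1,2)] dets onK
    by (simp add: neg_pedal_circle_def u_def v_def w_def)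
  then show ?thesis using that[OF circE D pedal] chE by simp
qed

lemma inj_pole_to_neg_pedal:
  assumes "r > 0" "R > 0" "D \<notin> sphere cen R"
  shows "inj (pole_to_neg_pedal D r cen R)"
proof (rule injI)
  fix X Y assume eq: "pole_to_neg_pedal D r cen R X = pole_to_neg_pedal D r cen R Y"
  have "circle_power D cen R \<noteq> 0" using assms(2,3) by (simp add: circle_power_eq_0_iff)
  then show "X = Y" using eq assms(1) by (simp add: pole_to_neg_pedal_def)
qed

theorem proposition9:
  fixes D cen :: point and r R :: real
  assumes "r > 0" and "R > 0" and "D \<notin> sphere cen R"
  shows "(\<forall>A B C. inscribed_avoiding (sphere cen R) D A B C \<longrightarrow>
            homothetic (neg_pedal_circle D A B C) (inverse_set D r (pedal_circle D A B C))) \<and>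
         (\<forall>A B C A' B' C'.
            inscribed_avoiding (sphere cen R) D A B C \<longrightarrow>
            inscribed_avoiding (sphere cen R) D A' B' C' \<longrightarrow>
            (pedal_circle D A B C = pedal_circle D A' B' C' \<longleftrightarrow>
             neg_pedal_circle D A B C = neg_pedal_circle D A' B' C'))"
proof (intro conjI allI impI)
  fix A B C assume "inscribed_avoiding (sphere cen R) D A B C"
  then obtain E where E: "is_circle E" "D \<notin> E" "pedal_circle D A B C = inversion D r ` E"
    "is_circle (neg_pedal_circle D A B C)"
    using pole_circle[OF assms] by metis
  have "inverse_set D r (pedal_circle D A B C) = E"
    using inversion_circle(2,3)[OF assms(1) E(1,2)] by (simp add: inverse_set_def E(3))
  then show "homothetic (neg_pedal_circle D A B C) (inverse_set D r (pedal_circle D A B C))"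
    using homothetic_circles E by simp
next
  fix A B C A' B' C'
  assume "inscribed_avoiding (sphere cen R) D A B C" "inscribed_avoiding (sphere cen R) D A' B' C'"
  then obtain E E' where E: "is_circle E" "D \<notin> E" "pedal_circle D A B C = inversion D r ` E"
    "neg_pedal_circle D A B C = pole_to_neg_pedal D r cen R ` E"
    and E': "is_circle E'" "D \<notin> E'" "pedal_circle D A' B' C' = inversion D r ` E'"
    "neg_pedal_circle D A' B' C' = pole_to_neg_pedal D r cen R ` E'"
    using pole_circle[OF assms] by metis
  have "pedal_circle D A B C = pedal_circle D A' B' C' \<longleftrightarrow> E = E'"
    using inversion_circle(3)[OF assms(1)] E(1-3) E'(1-3) by metis
  also have "\<dots> \<longleftrightarrow> neg_pedal_circle D A B C = neg_pedal_circle D A' B' C'"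
    unfolding E(4) E'(4) by (simp add: inj_image_eq_iff[OF inj_pole_to_neg_pedal[OF assms]])
  finally show "pedal_circle D A B C = pedal_circle D A' B' C' \<longleftrightarrow>
      neg_pedal_circle D A B C = neg_pedal_circle D A' B' C'" .
qed

end
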